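(* Let $\Phi$ be an Orlicz function, let $w=(w_m)_{m\in\mathbb{Z}}$ be a sequence of weights with $w_m>0$ for every $m\in\mathbb{Z}$, and let $k\in\mathbb{R}$. Then the linear space $\mathsf{s}_{k,\Phi,w}$ is a complex Banach space (with respect to the norm $\|\cdot\|_{k,\Phi,w}$), and it is the largest linear subspace contained in the class $\mathsf{c}_{k,\Phi,w}$ (that is, $\mathsf{s}_{k,\Phi,w}\subseteq\mathsf{c}_{k,\Phi,w}$, and every complex linear subspace $\mathsf{S}$ of the space of complex sequences with $\mathsf{S}\subseteq\mathsf{c}_{k,\Phi,w}$ satisfies $\mathsf{S}\subseteq\mathsf{s}_{k,\Phi,w}$). Moreover, $\mathsf{s}_{k,\Phi,w}$ is separable.
   Context: An Orlicz function is a continuous, non-decreasing, convex function $\Phi:[0,+\infty)\to[0,+\infty)$ with $\Phi(0)=0$, $\Phi(t)>0$ for every $t>0$ and $\lim_{t\to+\infty}\Phi(t)=+\infty$. Given such $\Phi$, positive weights $w=(w_m)_{m\in\mathbb{Z}}$ and $k\in\mathbb{R}$, the class $\mathsf{c}_{k,\Phi,w}$ is the set of all complex sequences $\mathsf{p}=(p_m)_{m\in\mathbb{Z}}$ satisfying $$\sum_{m\in\mathbb{Z}}w_m(1+\Phi(|m|))^k\,\Phi(|p_m|)<+\infty.$$ For a complex sequence $\mathsf{p}=(p_m)_{m\in\mathbb{Z}}$ put $$\|\mathsf{p}\|_{k,\Phi,w}:=\inf\Big\{\rho>0:\ \sum_{m\in\mathbb{Z}}w_m(1+\Phi(|m|))^k\,\Phi\Big(\frac{|p_m|}{\rho}\Big)\le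 1\Big\}$$ (with $\inf\emptyset=+\infty$), and let $l_{k,\Phi,w}$ be the set of all complex sequences with $\|\mathsf{p}\|_{k,\Phi,w}<+\infty$; it is a normed vector space under componentwise operations and the norm $\|\cdot\|_{k,\Phi,w}$. The space $\mathsf{s}_{k,\Phi,w}$ is the vector subspace of $l_{k,\Phi,w}$ consisting of all complex sequences $\mathsf{p}$ such that $$\sum_{m\in\mathbb{Z}}w_m(1+\Phi(|m|))^k\,\Phi\Big(\frac{|p_m|}{\rho}\Big)<+\infty\quad\text{for every }\rho>0,$$ equipped with the norm $\|\cdot\|_{k,\Phi,w}$. *)

theory Defs
  imports "HOL-Analysis.Analysis" "HOL-Library.Function_Algebras"
begin

text \<open>
  An Orlicz function is represented by a total function on \<^typ>\<open>real\<close>; only its values on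
  \<open>[0, \<infinity>)\<close> matter.
\<close>

definition orlicz :: "(real \<Rightarrow> real) \<Rightarrow> bool" where
  "orlicz \<Phi> \<longleftrightarrow>
     \<Phi> \<in> {0..} \<rightarrow> {0..} \<and>
     continuous_on {0..} \<Phi> \<and> mono_on {0..} \<Phi> \<and> convex_on {0..} \<Phi> \<and>
     \<Phi> 0 = 0 \<and> (\<forall>t>0. \<Phi> t > 0) \<and> filterlim \<Phi> at_top at_top"

text \<open>
  The weighted sum is taken in \<^typ>\<open>ennreal\<close>, where every family is summable, so that
  convergence of the series is finiteness of the sum.
\<close>

definition orlicz_sum ::
  "real \<Rightarrow> (real \<Rightarrow> real) \<Rightarrow> (int \<Rightarrow> real) \<Rightarrow> (int \<Rightarrow> real) \<Rightarrow> ennreal" where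
  "orlicz_sum k \<Phi> w a =
     (\<Sum>\<^sub>\<infinity>m. ennreal (w m * (1 + \<Phi> \<bar>real_of_int m\<bar>) powr k * \<Phi> (a m)))"

definition orlicz_class ::
  "real \<Rightarrow> (real \<Rightarrow> real) \<Rightarrow> (int \<Rightarrow> real) \<Rightarrow> (int \<Rightarrow> complex) set" where
  "orlicz_class k \<Phi> w = {p. orlicz_sum k \<Phi> w (\<lambda>m. cmod (p m)) < \<infinity>}"

definition orlicz_norm ::
  "real \<Rightarrow> (real \<Rightarrow> real) \<Rightarrow> (int \<Rightarrow> real) \<Rightarrow> (int \<Rightarrow> complex) \<Rightarrow> ennreal" where
  "orlicz_norm k \<Phi> w p =
     (INF \<rho>\<in>{\<rho>::real. \<rho> > 0 \<and> orlicz_sum k \<Phi> w (\<lambda>m. cmod (p m) / \<rho>) \<le> 1}. ennreal \<rho>)"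

definition orlicz_l ::
  "real \<Rightarrow> (real \<Rightarrow> real) \<Rightarrow> (int \<Rightarrow> real) \<Rightarrow> (int \<Rightarrow> complex) set" where
  "orlicz_l k \<Phi> w = {p. orlicz_norm k \<Phi> w p < \<infinity>}"

definition orlicz_s ::
  "real \<Rightarrow> (real \<Rightarrow> real) \<Rightarrow> (int \<Rightarrow> real) \<Rightarrow> (int \<Rightarrow> complex) set" where
  "orlicz_s k \<Phi> w =
     {p \<in> orlicz_l k \<Phi> w. \<forall>\<rho>>0. orlicz_sum k \<Phi> w (\<lambda>m. cmod (p m) / \<rho>) < \<infinity>}"

text \<open>
  The additive structure on sequences is the pointwise one of
  \<^theory>\<open>HOL-Library.Function_Algebras\<close>.
\<close>

definition seq_scale :: "complex \<Rightarrow> (int \<Rightarrow> complex) \<Rightarrow> (int \<Rightarrow> complex)" where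
  "seq_scale c p = (\<lambda>m. c * p m)"

global_interpretation cseq: vector_space seq_scale
  by unfold_locales (auto simp: seq_scale_def fun_eq_iff algebra_simps)

definition complex_normed_on ::
  "(int \<Rightarrow> complex) set \<Rightarrow> ((int \<Rightarrow> complex) \<Rightarrow> real) \<Rightarrow> bool" where
  "complex_normed_on V N \<longleftrightarrow>
     cseq.subspace V \<and>
     (\<forall>p\<in>V. N p \<ge> 0) \<and>
     (\<forall>p\<in>V. N p = 0 \<longleftrightarrow> p = 0) \<and>
     (\<forall>c. \<forall>p\<in>V. N (seq_scale c p) = cmod c * N p) \<and>
     (\<forall>p\<in>V. \<forall>q\<in>V. N (p + q) \<le> N p + N q)"

text \<open>
  The distance induced by a norm. \<^const>\<open>Metric_space.mcomplete\<close> and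
  \<^const>\<open>Metric_space.mtopology\<close> depend only on its values on the carrier, where the norm
  axioms make it a metric. The locale \<^locale>\<open>Metric_space\<close> also asks for non-negativity and
  symmetry off the carrier; these hold for the norm \<open>orlicz_rnorm\<close> below.
\<close>

definition norm_dist ::
  "((int \<Rightarrow> complex) \<Rightarrow> real) \<Rightarrow> (int \<Rightarrow> complex) \<Rightarrow> (int \<Rightarrow> complex) \<Rightarrow> real" where
  "norm_dist N p q = N (p - q)"

definition complex_banach_on ::
  "(int \<Rightarrow> complex) set \<Rightarrow> ((int \<Rightarrow> complex) \<Rightarrow> real) \<Rightarrow> bool" where
  "complex_banach_on V N \<longleftrightarrow>
     complex_normed_on V N \<and> Metric_space.mcomplete V (norm_dist N)"

definition separable_on ::
  "(int \<Rightarrow> complex) set \<Rightarrow> ((int \<Rightarrow> complex) \<Rightarrow> real) \<Rightarrow> bool" where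
  "separable_on V N \<longleftrightarrow> separable_space (Metric_space.mtopology V (norm_dist N))"

text \<open>
  The norm as a real number. It agrees with \<^const>\<open>orlicz_norm\<close> on \<^const>\<open>orlicz_l\<close>, hence on
  \<^const>\<open>orlicz_s\<close>; the default value \<open>0\<close> for an infinite norm is never used there.
\<close>

definition orlicz_rnorm ::
  "real \<Rightarrow> (real \<Rightarrow> real) \<Rightarrow> (int \<Rightarrow> real) \<Rightarrow> (int \<Rightarrow> complex) \<Rightarrow> real" where
  "orlicz_rnorm k \<Phi> w p = enn2real (orlicz_norm k \<Phi> w p)"

end

theory Submission
  imports Defs
begin

text \<open>
  By lower semicontinuity of the modular the infimum defining the norm is attained, so the norm of
  \<open>p\<close> is at most \<open>r\<close> iff the modular of \<open>p / r\<close> is at most \<open>1\<close>. The norm axioms then follow from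
  convexity, and completeness from coordinatewise limits. The space consists of exactly the
  sequences all of whose multiples lie in the class, which gives maximality. For separability,
  the modular of \<open>p / \<epsilon>\<close> outside a suitable finite set is at most \<open>1/2\<close>; on that finite set \<open>p\<close> is
  approximated by values from a countable dense set, at a cost of another \<open>1/2\<close>.
\<close>

locale weighted_orlicz =
  fixes k :: real and \<Phi> :: "real \<Rightarrow> real" and w :: "int \<Rightarrow> real"
  assumes orlicz: "orlicz \<Phi>" and weight_pos: "\<And>m. w m > 0"
begin

section \<open>The Orlicz function and the combined weights\<close>

definition v :: "int \<Rightarrow> real" where
  "v m = w m * (1 + \<Phi> \<bar>real_of_int m\<bar>) powr k"

lemma Phi_nonneg: "0 \<le> t \<Longrightarrow> 0 \<le> \<Phi> t"
  using orlicz by (auto simp: orlicz_def Pi_iff)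

lemma Phi_mono: "0 \<le> s \<Longrightarrow> s \<le> t \<Longrightarrow> \<Phi> s \<le> \<Phi> t"
  using orlicz by (auto simp: orlicz_def mono_on_def)

lemma Phi_zero [simp]: "\<Phi> 0 = 0"
  using orlicz by (simp add: orlicz_def)

lemma Phi_convex:
  assumes "0 \<le> s" "0 \<le> t" "0 \<le> x" "0 \<le> y" "x + y = 1"
  shows "\<Phi> (x * s + y * t) \<le> x * \<Phi> s + y * \<Phi> t"
proof -
  have "convex_on {0..} \<Phi>" using orlicz by (simp add: orlicz_def)
  then show ?thesis using assms unfolding convex_on_def by simp
qed

text \<open>Convexity between \<open>t\<close> and the point 0, where \<open>\<Phi>\<close>
  vanishes.\<close>

lemma Phi_mult_le:
  assumes "0 \<le> t" "0 \<le> x" "x \<le> 1"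
  shows "\<Phi> (x * t) \<le> x * \<Phi> t"
  using Phi_convex[of t 0 x "1 - x"] assms by simp

text \<open>Continuity is available on the half-line only, so \<open>f\<close> must eventually take
  its values there.\<close>

lemma Phi_tendsto:
  assumes "(f \<longlongrightarrow> l) F" "eventually (\<lambda>x. 0 \<le> f x) F" "0 \<le> l"
  shows "((\<lambda>x. \<Phi> (f x)) \<longlongrightarrow> \<Phi> l) F"
proof (rule continuous_on_tendsto_compose[of "{0..}" \<Phi>])
  show "continuous_on {0..} \<Phi>" using orlicz by (simp add: orlicz_def)
qed (use assms in auto)

lemma v_pos: "0 < v m"
proof -
  have "0 < 1 + \<Phi> \<bar>real_of_int m\<bar>" using Phi_nonneg[of "\<bar>real_of_int m\<bar>"] by linarith
  then show ?thesis unfolding v_def using weight_pos[of m] by simp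
qed

section \<open>Finite partial sums and the modular\<close>

text \<open>A sum of nonnegative terms is the supremum of its finite partial sums. This moves all
  later estimates from \<open>ennreal\<close> to finite real sums. Nonnegativity of \<open>C\<close>
  matters because \<open>ennreal\<close> sends negative numbers to 0.\<close>

lemma orlicz_sum_le_iff:
  assumes a: "\<And>m. 0 \<le> a m" and C: "0 \<le> C"
  shows "orlicz_sum k \<Phi> w a \<le> ennreal C \<longleftrightarrow>
         (\<forall>F. finite F \<longrightarrow> (\<Sum>m\<in>F. v m * \<Phi> (a m)) \<le> C)"
proof -
  let ?f = "\<lambda>m. ennreal (v m * \<Phi> (a m))"
  have nn: "0 \<le> v m * \<Phi> (a m)" for m
    using v_pos[of m] Phi_nonneg[OF a[of m]] by simp
  have eq: "orlicz_sum k \<Phi> w a = infsum ?f UNIV" unfolding orlicz_sum_def v_def ..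
  have sm: "?f summable_on UNIV" by (rule nonneg_summable_on_complete) simp
  have fin: "sum ?f F = ennreal (\<Sum>m\<in>F. v m * \<Phi> (a m))" for F
    by (rule sum_ennreal) (use nn in auto)
  show ?thesis
  proof
    assume L: "orlicz_sum k \<Phi> w a \<le> ennreal C"
    show "\<forall>F. finite F \<longrightarrow> (\<Sum>m\<in>F. v m * \<Phi> (a m)) \<le> C"
    proof (intro allI impI)
      fix F :: "int set" assume F: "finite F"
      have "sum ?f F = infsum ?f F" using F by simp
      also have "\<dots> \<le> infsum ?f UNIV"
        by (rule infsum_mono_neutral[OF _ sm]) (use F in auto)
      finally show "(\<Sum>m\<in>F. v m * \<Phi> (a m)) \<le> C"
        using L C unfolding eq fin by (meson ennreal_le_iff order_trans)
    qed
  next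
    assume "\<forall>F. finite F \<longrightarrow> (\<Sum>m\<in>F. v m * \<Phi> (a m)) \<le> C"
    then show "orlicz_sum k \<Phi> w a \<le> ennreal C"
      unfolding eq by (intro infsum_le_finite_sums[OF sm]) (simp only: fin, simp add: ennreal_leI)
  qed
qed

definition modular :: "(int \<Rightarrow> complex) \<Rightarrow> real \<Rightarrow> ennreal" where
  "modular p r = orlicz_sum k \<Phi> w (\<lambda>m. cmod (p m) / r)"

lemma modular_le_iff:
  assumes "0 < r" "0 \<le> C"
  shows "modular p r \<le> ennreal C \<longleftrightarrow>
         (\<forall>F. finite F \<longrightarrow> (\<Sum>m\<in>F. v m * \<Phi> (cmod (p m) / r)) \<le> C)"
  unfolding modular_def using assms by (intro orlicz_sum_le_iff) auto

lemma modular_le_one_iff: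
  assumes "0 < r"
  shows "modular p r \<le> 1 \<longleftrightarrow>
         (\<forall>F. finite F \<longrightarrow> (\<Sum>m\<in>F. v m * \<Phi> (cmod (p m) / r)) \<le> 1)"
  using modular_le_iff[OF assms, of 1 p] by simp

lemma modular_finiteE:
  assumes "modular p r < \<infinity>"
  obtains C where "0 \<le> C" "modular p r \<le> ennreal C"
  using assms by (cases "modular p r") auto

lemma modular_finiteI: "modular p r \<le> ennreal C \<Longrightarrow> modular p r < \<infinity>"
  by (simp add: ennreal_less_top order_le_less_trans)

lemma modular_scale:
  assumes "c \<noteq> 0"
  shows "modular (seq_scale c p) (cmod c * r) = modular p r"
  unfolding modular_def seq_scale_def using assms by (simp add: norm_mult)

text \<open>The sequence \<open>(p + q) / (s + t)\<close> is the convex combination of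
  \<open>p / s\<close> and \<open>q / t\<close> with coefficients \<open>s / (s + t)\<close> and
  \<open>t / (s + t)\<close>, and the bound combines \<open>C\<close> and \<open>D\<close> in the
  same way. With \<open>C = D = 1\<close> this gives the triangle inequality; with
  \<open>s = t\<close> it gives closure under addition.\<close>

lemma modular_add:
  assumes s: "0 < s" and t: "0 < t" and C: "0 \<le> C" and D: "0 \<le> D"
    and p: "modular p s \<le> ennreal C" and q: "modular q t \<le> ennreal D"
  shows "modular (p + q) (s + t) \<le> ennreal ((s * C + t * D) / (s + t))"
proof -
  let ?x = "s / (s + t)" and ?y = "t / (s + t)"
  have xy: "0 \<le> ?x" "0 \<le> ?y" "?x + ?y = 1" using s t by (auto simp flip: add_divide_distrib)
  have st: "0 < s + t" using s t by simp
  have "(\<Sum>m\<in>F. v m * \<Phi> (cmod ((p + q) m) / (s + t))) \<le> (s * C + t * D) / (s + t)"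
    if F: "finite F" for F
  proof -
    have P: "(\<Sum>m\<in>F. v m * \<Phi> (cmod (p m) / s)) \<le> C"
      using p modular_le_iff[OF s C] F by blast
    have Q: "(\<Sum>m\<in>F. v m * \<Phi> (cmod (q m) / t)) \<le> D"
      using q modular_le_iff[OF t D] F by blast
    have "v m * \<Phi> (cmod ((p + q) m) / (s + t)) \<le>
          ?x * (v m * \<Phi> (cmod (p m) / s)) + ?y * (v m * \<Phi> (cmod (q m) / t))" for m
    proof -
      have "cmod ((p + q) m) / (s + t) \<le> (cmod (p m) + cmod (q m)) / (s + t)"
        using st by (simp add: divide_right_mono norm_triangle_ineq)
      also have "\<dots> = ?x * (cmod (p m) / s) + ?y * (cmod (q m) / t)"
        using s t by (simp add: add_divide_distrib)
      finally have "\<Phi> (cmod ((p + q) m) / (s + t)) \<le> \<Phi> (?x * (cmod (p m) / s) + ?y * (cmod (q m) / t))"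
        using st by (intro Phi_mono) auto
      also have "\<dots> \<le> ?x * \<Phi> (cmod (p m) / s) + ?y * \<Phi> (cmod (q m) / t)"
        using s t xy by (intro Phi_convex) auto
      finally have "v m * \<Phi> (cmod ((p + q) m) / (s + t)) \<le>
          v m * (?x * \<Phi> (cmod (p m) / s) + ?y * \<Phi> (cmod (q m) / t))"
        using v_pos[of m] by (intro mult_left_mono) simp_all
      then show ?thesis by (simp only: distrib_left mult.left_commute[of "v m"])
    qed
    then have "(\<Sum>m\<in>F. v m * \<Phi> (cmod ((p + q) m) / (s + t))) \<le>
        (\<Sum>m\<in>F. ?x * (v m * \<Phi> (cmod (p m) / s)) + ?y * (v m * \<Phi> (cmod (q m) / t)))"
      by (intro sum_mono)
    also have "\<dots> = ?x * (\<Sum>m\<in>F. v m * \<Phi> (cmod (p m) / s)) + ?y * (\<Sum>m\<in>F. v m * \<Phi> (cmod (q m) / t))"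
      by (simp add: sum.distrib sum_distrib_left)
    also have "\<dots> \<le> ?x * C + ?y * D"
      using P Q xy by (intro add_mono mult_left_mono)
    finally show ?thesis by (simp add: add_divide_distrib)
  qed
  then show ?thesis using s t C D by (subst modular_le_iff) auto
qed

lemma modular_antimono:
  assumes "0 < r" "r \<le> s"
  shows "modular p s \<le> modular p r"
  unfolding modular_def orlicz_sum_def
proof (rule infsum_mono)
  fix m
  have "\<Phi> (cmod (p m) / s) \<le> \<Phi> (cmod (p m) / r)"
    using assms by (intro Phi_mono) (auto intro: divide_left_mono)
  then show "ennreal (w m * (1 + \<Phi> \<bar>real_of_int m\<bar>) powr k * \<Phi> (cmod (p m) / s))
    \<le> ennreal (w m * (1 + \<Phi> \<bar>real_of_int m\<bar>) powr k * \<Phi> (cmod (p m) / r))"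
    using v_pos[of m] by (intro ennreal_leI mult_left_mono) (auto simp: v_def)
qed (rule nonneg_summable_on_complete, simp)+

text \<open>By \<open>Phi_mult_le\<close>, dividing the argument by \<open>C\<close> divides each
  term by at least \<open>C\<close>. Hence a finite modular at one radius already yields a finite
  norm.\<close>

lemma modular_rescale:
  assumes r: "0 < r" and C: "1 \<le> C" and p: "modular p r \<le> ennreal C"
  shows "modular p (C * r) \<le> 1"
proof -
  have "(\<Sum>m\<in>F. v m * \<Phi> (cmod (p m) / (C * r))) \<le> 1" if F: "finite F" for F
  proof -
    have "v m * \<Phi> (cmod (p m) / (C * r)) \<le> (1 / C) * (v m * \<Phi> (cmod (p m) / r))" for m
      using Phi_mult_le[of "cmod (p m) / r" "1 / C"] C r v_pos[of m]
      by (simp add: field_simps)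
    then have "(\<Sum>m\<in>F. v m * \<Phi> (cmod (p m) / (C * r))) \<le> (1 / C) * (\<Sum>m\<in>F. v m * \<Phi> (cmod (p m) / r))"
      by (simp only: sum_distrib_left sum_mono)
    also have "\<dots> \<le> (1 / C) * C"
      using p C r F modular_le_iff[of r C p] by (intro mult_left_mono) auto
    finally show ?thesis using C by simp
  qed
  then show ?thesis using C r by (subst modular_le_one_iff) auto
qed

section \<open>Attainment of the infimum in the norm\<close>

text \<open>The nontrivial direction says that the infimum is attained: each finite sum is
  continuous in the radius, so a bound at all radii above \<open>r\<close> survives the limit from
  the right.\<close>

lemma orlicz_norm_le_iff:
  assumes r: "0 < r"
  shows "orlicz_norm k \<Phi> w p \<le> ennreal r \<longleftrightarrow> modular p r \<le> 1"
proof
  assume "modular p r \<le> 1"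
  then show "orlicz_norm k \<Phi> w p \<le> ennreal r"
    unfolding orlicz_norm_def modular_def using r by (intro INF_lower) auto
next
  assume L: "orlicz_norm k \<Phi> w p \<le> ennreal r"
  \<comment> \<open>The infimum only supplies some admissible \<open>u < s\<close>;
    \<open>modular_antimono\<close> carries admissibility from \<open>u\<close> up to
    \<open>s\<close>.\<close>
  have above: "modular p s \<le> 1" if "r < s" for s
  proof -
    have "orlicz_norm k \<Phi> w p < ennreal s"
      using L that r by (simp add: order_le_less_trans ennreal_lessI)
    then obtain u where "0 < u" "modular p u \<le> 1" "ennreal u < ennreal s"
      unfolding orlicz_norm_def modular_def by (auto simp: INF_less_iff)
    then show ?thesis
      using modular_antimono[of u s p] by (simp add: ennreal_less_iff)
  qed
  have "(\<Sum>m\<in>F. v m * \<Phi> (cmod (p m) / r)) \<le> 1" if F: "finite F" for F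
  proof (rule tendsto_upperbound)
    show "((\<lambda>s. \<Sum>m\<in>F. v m * \<Phi> (cmod (p m) / s)) \<longlongrightarrow> (\<Sum>m\<in>F. v m * \<Phi> (cmod (p m) / r))) (at_right r)"
    proof (intro tendsto_sum tendsto_mult tendsto_const Phi_tendsto)
      show "eventually (\<lambda>s. 0 \<le> cmod (p m) / s) (at_right r)" for m
        using eventually_at_right_less[of r] by eventually_elim (use r in auto)
    qed (use r in \<open>auto intro!: tendsto_eq_intros\<close>)
    show "eventually (\<lambda>s. (\<Sum>m\<in>F. v m * \<Phi> (cmod (p m) / s)) \<le> 1) (at_right r)"
      using eventually_at_right_less[of r]
    proof eventually_elim
      case (elim s)
      then show ?case using above[of s] modular_le_one_iff[of s p] r F by auto
    qed
  qed simp
  then show "modular p r \<le> 1" using modular_le_one_iff[OF r] by blast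
qed

section \<open>The space, its linear structure and its norm\<close>

abbreviation N :: "(int \<Rightarrow> complex) \<Rightarrow> real" where
  "N \<equiv> orlicz_rnorm k \<Phi> w"

abbreviation s :: "(int \<Rightarrow> complex) set" where
  "s \<equiv> orlicz_s k \<Phi> w"

lemma mem_l_iff: "p \<in> orlicz_l k \<Phi> w \<longleftrightarrow> (\<exists>r>0. modular p r \<le> 1)"
  unfolding orlicz_l_def orlicz_norm_def modular_def
  by (auto simp: INF_less_iff top.not_eq_extremum)

lemma mem_s_iff: "p \<in> s \<longleftrightarrow> (\<forall>r>0. modular p r < \<infinity>)"
proof -
  have "p \<in> orlicz_l k \<Phi> w" if fin: "\<forall>r>0. modular p r < \<infinity>"
  proof -
    obtain C where C: "0 \<le> C" "modular p 1 \<le> ennreal C"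
      using fin modular_finiteE[of p 1] by auto
    then have "modular p 1 \<le> ennreal (max 1 C)"
      by (meson ennreal_leI max.cobounded2 order_trans)
    \<comment> \<open>The bound is raised to at least 1, as \<open>modular_rescale\<close>
      requires.\<close>
    then have "modular p (max 1 C * 1) \<le> 1" by (intro modular_rescale) auto
    then show ?thesis unfolding mem_l_iff by (intro exI[of _ "max 1 C * 1"]) auto
  qed
  then show ?thesis unfolding orlicz_s_def modular_def by auto
qed

lemma s_subset_l: "s \<subseteq> orlicz_l k \<Phi> w"
  unfolding orlicz_s_def by auto

lemma N_nonneg: "0 \<le> N p"
  unfolding orlicz_rnorm_def by simp

text \<open>On \<open>orlicz_l\<close> the extended norm is finite, so \<open>enn2real\<close> loses
  no information and \<open>orlicz_norm_le_iff\<close> transfers to real numbers.\<close>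

lemma N_le_iff:
  assumes "p \<in> orlicz_l k \<Phi> w" "0 < r"
  shows "N p \<le> r \<longleftrightarrow> modular p r \<le> 1"
proof -
  have "orlicz_norm k \<Phi> w p = ennreal (N p)"
    using assms(1) unfolding orlicz_rnorm_def orlicz_l_def by simp
  then show ?thesis using orlicz_norm_le_iff[OF assms(2), of p] assms(2) by simp
qed

lemma N_le:
  assumes "0 < r" "modular p r \<le> 1"
  shows "N p \<le> r"
  using N_le_iff[of p r] mem_l_iff assms by blast

lemma subspace_s: "cseq.subspace s"
proof (rule cseq.subspaceI)
  show "0 \<in> s" by (auto simp: mem_s_iff modular_def orlicz_sum_def)
next
  fix p q assume p: "p \<in> s" and q: "q \<in> s"
  show "p + q \<in> s" unfolding mem_s_iff
  proof (intro allI impI)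
    fix r :: real assume r: "0 < r"
    \<comment> \<open>The radius is split as \<open>r = r / 2 + r / 2\<close> to match
      \<open>modular_add\<close>; finiteness at every radius is what makes both halves
      available.\<close>
    obtain C where C: "0 \<le> C" "modular p (r / 2) \<le> ennreal C"
      using p r modular_finiteE[of p "r / 2"] by (auto simp: mem_s_iff)
    obtain D where D: "0 \<le> D" "modular q (r / 2) \<le> ennreal D"
      using q r modular_finiteE[of q "r / 2"] by (auto simp: mem_s_iff)
    from modular_add[OF _ _ C(1) D(1) C(2) D(2)] r
    show "modular (p + q) r < \<infinity>" by (intro modular_finiteI[of _ _ "(r * C / 2 + r * D / 2) / r"]) simp
  qed
next
  fix c p assume p: "p \<in> s"
  show "seq_scale c p \<in> s"
  proof (cases "c = 0")
    case True
    then show ?thesis by (auto simp: mem_s_iff modular_def orlicz_sum_def seq_scale_def)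
  next
    case False
    then have "modular (seq_scale c p) r = modular p (r / cmod c)" for r
      using modular_scale[of c p "r / cmod c"] by simp
    then show ?thesis using p False by (auto simp: mem_s_iff)
  qed
qed

lemma N_scale:
  assumes p: "p \<in> orlicz_l k \<Phi> w"
  shows "N (seq_scale c p) = cmod c * N p"
proof (cases "c = 0")
  case True
  have "N (seq_scale c p) \<le> r" if "0 < r" for r
    using that True by (intro N_le) (auto simp: modular_def orlicz_sum_def seq_scale_def)
  then have "N (seq_scale c p) \<le> 0" by (auto intro: dense_ge)
  then show ?thesis using True N_nonneg[of "seq_scale c p"] by simp
next
  case False
  \<comment> \<open>One inequality for all nonzero scalars suffices: applied to
    \<open>inverse c\<close> and \<open>seq_scale c p\<close> it gives the reverse
    inequality.\<close>
  have *: "N (seq_scale d q) \<le> cmod d * N q" if d: "d \<noteq> 0" and q: "q \<in> orlicz_l k \<Phi> w" for d q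
  proof (rule field_le_epsilon)
    fix e :: real assume e: "0 < e"
    \<comment> \<open>The excess \<open>e / cmod d\<close> becomes \<open>e\<close> after
      multiplication by \<open>cmod d\<close>, and it keeps the radius positive even when
      \<open>N q = 0\<close>.\<close>
    let ?r = "N q + e / cmod d"
    have r: "0 < ?r" using N_nonneg[of q] e d by (simp add: add_nonneg_pos)
    have "modular q ?r \<le> 1" using N_le_iff[OF q r] e by simp
    then have "modular (seq_scale d q) (cmod d * ?r) \<le> 1" using modular_scale[OF d, of q ?r] by simp
    then have "N (seq_scale d q) \<le> cmod d * ?r" using r d by (intro N_le) auto
    also have "\<dots> = cmod d * N q + e" using d by (simp add: distrib_left)
    finally show "N (seq_scale d q) \<le> cmod d * N q + e" .
  qed
  obtain r where r: "0 < r" "modular p r \<le> 1" using p mem_l_iff by blast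
  have l: "seq_scale c p \<in> orlicz_l k \<Phi> w"
    unfolding mem_l_iff using r False modular_scale[OF False, of p r]
    by (intro exI[of _ "cmod c * r"]) auto
  have "seq_scale (inverse c) (seq_scale c p) = p"
    using False by (simp add: seq_scale_def fun_eq_iff flip: mult.assoc)
  then have "N p \<le> N (seq_scale c p) / cmod c"
    using *[OF _ l, of "inverse c"] False by (simp add: norm_inverse divide_inverse mult.commute)
  then have "cmod c * N p \<le> N (seq_scale c p)"
    using False by (simp add: pos_le_divide_eq mult.commute)
  then show ?thesis using *[OF False p] by linarith
qed

lemma N_triangle:
  assumes p: "p \<in> orlicz_l k \<Phi> w" and q: "q \<in> orlicz_l k \<Phi> w"
  shows "N (p + q) \<le> N p + N q"
proof (rule field_le_epsilon)
  fix e :: real assume e: "0 < e"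
  have a: "0 < N p + e / 2" "0 < N q + e / 2"
    using N_nonneg[of p] N_nonneg[of q] e by linarith+
  have "modular p (N p + e / 2) \<le> ennreal 1" "modular q (N q + e / 2) \<le> ennreal 1"
    using N_le_iff[OF p a(1)] N_le_iff[OF q a(2)] e by auto
  from modular_add[OF a _ _ this]
  have "modular (p + q) (N p + e / 2 + (N q + e / 2)) \<le> 1" using a by simp
  then have "N (p + q) \<le> N p + e / 2 + (N q + e / 2)" using a by (intro N_le) auto
  then show "N (p + q) \<le> N p + N q + e" by simp
qed

text \<open>A single term of the modular is at most 1, so \<open>\<Phi>\<close> of the scaled
  coordinate is at most \<open>1 / v m\<close>. Since \<open>\<Phi>\<close> is unbounded, some
  \<open>T\<close> has a larger value, and monotonicity bounds the coordinate. This \<open>T\<close>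
  depends on \<open>m\<close> but not on \<open>p\<close>, so coordinates are continuous in the
  norm.\<close>

lemma coordinate_bound:
  obtains T where "0 < T" "\<And>p. p \<in> orlicz_l k \<Phi> w \<Longrightarrow> cmod (p m) \<le> T * N p"
proof -
  have "filterlim \<Phi> at_top at_top" using orlicz by (simp add: orlicz_def)
  then have "eventually (\<lambda>t. 1 / v m < \<Phi> t) at_top" by (simp add: filterlim_at_top_dense)
  then have "eventually (\<lambda>t. 1 / v m < \<Phi> t \<and> 0 < t) at_top"
    using eventually_gt_at_top by (rule eventually_conj)
  then obtain T where T: "1 / v m < \<Phi> T" "0 < T"
    using eventually_happens'[OF trivial_limit_at_top_linorder] by blast
  have "cmod (p m) \<le> T * N p" if p: "p \<in> orlicz_l k \<Phi> w" for p
  proof (rule field_le_epsilon)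
    fix e :: real assume e: "0 < e"
    \<comment> \<open>The excess \<open>e / T\<close> keeps the radius positive and contributes
      exactly \<open>e\<close> after multiplication by \<open>T\<close>.\<close>
    let ?r = "N p + e / T"
    have r: "0 < ?r" using N_nonneg[of p] e T by (simp add: add_nonneg_pos)
    have "modular p ?r \<le> 1" using N_le_iff[OF p r] e T by simp
    then have "(\<Sum>m\<in>{m}. v m * \<Phi> (cmod (p m) / ?r)) \<le> 1"
      using modular_le_one_iff[OF r] by blast
    then have "\<Phi> (cmod (p m) / ?r) \<le> 1 / v m" using v_pos[of m] by (simp add: field_simps)
    then have "\<Phi> (cmod (p m) / ?r) < \<Phi> T" using T by linarith
    then have "cmod (p m) / ?r < T"
      using Phi_mono[of T "cmod (p m) / ?r"] T by linarith
    then have "cmod (p m) < T * ?r" using r by (simp add: pos_divide_less_eq)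
    also have "T * ?r = T * N p + e" using T by (simp add: distrib_left)
    finally show "cmod (p m) \<le> T * N p + e" by simp
  qed
  then show ?thesis using that T by blast
qed

lemma N_eq_0_iff:
  assumes p: "p \<in> orlicz_l k \<Phi> w"
  shows "N p = 0 \<longleftrightarrow> p = 0"
proof
  assume "N p = 0"
  then have "p m = 0" for m
    using coordinate_bound[of m] p by (metis mult_zero_right norm_le_zero_iff)
  then show "p = 0" by auto
next
  assume "p = 0"
  then have "p = seq_scale 0 p" by (simp add: seq_scale_def fun_eq_iff)
  then show "N p = 0" using N_scale[OF p, of 0] by simp
qed

lemma complex_normed_on_s: "complex_normed_on s N"
  unfolding complex_normed_on_def
  by (simp add: subspace_s N_nonneg N_eq_0_iff N_scale N_triangle subsetD[OF s_subset_l])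

section \<open>Metric structure and completeness\<close>

text \<open>Proved from the definition for arbitrary sequences, because \<open>Metric_space\<close>
  asks for symmetry off the carrier as well.\<close>

lemma N_minus_commute: "N (p - q) = N (q - p)"
  unfolding orlicz_rnorm_def orlicz_norm_def by (simp add: norm_minus_commute)

lemma Metric_space_s: "Metric_space s (norm_dist N)"
proof
  fix p q r assume s: "p \<in> s" "q \<in> s"
  then have "p - q \<in> orlicz_l k \<Phi> w"
    using subspace_s s_subset_l cseq.subspace_diff by blast
  then show "norm_dist N p q = 0 \<longleftrightarrow> p = q" unfolding norm_dist_def by (simp add: N_eq_0_iff)
  assume r: "r \<in> s"
  have "p - q \<in> orlicz_l k \<Phi> w" "q - r \<in> orlicz_l k \<Phi> w"
    using s r subspace_s s_subset_l cseq.subspace_diff by blast+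
  from N_triangle[OF this] show "norm_dist N p r \<le> norm_dist N p q + norm_dist N q r"
    unfolding norm_dist_def by simp
qed (simp_all add: norm_dist_def N_nonneg N_minus_commute)

text \<open>A Fatou-type statement: coordinatewise convergence passes to the limit in each finite
  sum, and the finite sums determine the modular.\<close>

lemma modular_le_one_limit:
  assumes r: "0 < r" and lim: "\<And>m. (\<lambda>n. p n m) \<longlonglongrightarrow> q m"
    and ev: "eventually (\<lambda>n. modular (p n) r \<le> 1) sequentially"
  shows "modular q r \<le> 1"
proof -
  have "(\<Sum>m\<in>F. v m * \<Phi> (cmod (q m) / r)) \<le> 1" if F: "finite F" for F
  proof (rule tendsto_upperbound)
    show "(\<lambda>n. \<Sum>m\<in>F. v m * \<Phi> (cmod (p n m) / r)) \<longlonglongrightarrow> (\<Sum>m\<in>F. v m * \<Phi> (cmod (q m) / r))"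
    proof (intro tendsto_sum tendsto_mult tendsto_const Phi_tendsto)
      show "(\<lambda>n. cmod (p n m) / r) \<longlonglongrightarrow> cmod (q m) / r" for m
        using r by (intro tendsto_divide tendsto_norm lim tendsto_const) simp
    qed (use r in auto)
    show "eventually (\<lambda>n. (\<Sum>m\<in>F. v m * \<Phi> (cmod (p n m) / r)) \<le> 1) sequentially"
      using ev
    proof eventually_elim
      case (elim n)
      then show ?case using modular_le_one_iff[OF r, of "p n"] F by simp
    qed
  qed simp
  then show ?thesis using modular_le_one_iff[OF r] by blast
qed

lemma mcomplete_s: "Metric_space.mcomplete s (norm_dist N)"
proof -
  interpret Metric_space s "norm_dist N" by (rule Metric_space_s)
  show ?thesis unfolding mcomplete_def
  proof (intro allI impI)
    fix p assume C: "MCauchy p"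
    have ps: "p n \<in> s" for n using C unfolding MCauchy_def by auto
    have diff: "p n - p j \<in> orlicz_l k \<Phi> w" for n j
      using ps subspace_s s_subset_l cseq.subspace_diff by blast
    have cau: "\<exists>K. \<forall>n\<ge>K. \<forall>j\<ge>K. N (p n - p j) < e" if "0 < e" for e
    proof -
      have "\<forall>e>0. \<exists>K. \<forall>n j. K \<le> n \<longrightarrow> K \<le> j \<longrightarrow> N (p n - p j) < e"
        using C unfolding MCauchy_def norm_dist_def by (rule conjunct2)
      then show ?thesis using that by meson
    qed
    \<comment> \<open>By \<open>coordinate_bound\<close>, a Cauchy sequence in the norm is Cauchy in
      each coordinate.\<close>
    have conv: "convergent (\<lambda>n. p n m)" for m
    proof (rule Cauchy_convergent, rule metric_CauchyI)
      fix e :: real assume e: "0 < e"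
      obtain T where T: "0 < T" "\<And>p. p \<in> orlicz_l k \<Phi> w \<Longrightarrow> cmod (p m) \<le> T * N p"
        using coordinate_bound[of m] by blast
      obtain K where K: "\<forall>n\<ge>K. \<forall>j\<ge>K. N (p n - p j) < e / T" using cau[of "e / T"] e T by auto
      have "dist (p n m) (p j m) < e" if "n \<ge> K" "j \<ge> K" for n j
      proof -
        have "dist (p n m) (p j m) \<le> T * N (p n - p j)"
          using T(2)[OF diff[of n j]] by (simp add: dist_norm)
        also have "\<dots> < e" using K[rule_format, OF that] T by (simp add: pos_less_divide_eq mult.commute)
        finally show ?thesis .
      qed
      then show "\<exists>K. \<forall>n\<ge>K. \<forall>j\<ge>K. dist (p n m) (p j m) < e" by blast
    qed
    define q where "q = (\<lambda>m. lim (\<lambda>n. p n m))"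
    have q: "(\<lambda>n. p n m) \<longlonglongrightarrow> q m" for m
      using conv[of m] by (simp add: q_def convergent_LIMSEQ_iff)
    \<comment> \<open>Fix \<open>n\<close> and let \<open>j\<close> tend to infinity in
      \<open>p n - p j\<close>: the Cauchy estimate survives by
      \<open>modular_le_one_limit\<close>.\<close>
    have lim: "\<exists>K. \<forall>n\<ge>K. modular (p n - q) e \<le> 1" if e: "0 < e" for e
    proof -
      obtain K where K: "\<forall>n\<ge>K. \<forall>j\<ge>K. N (p n - p j) < e" using cau e by blast
      have "modular (p n - q) e \<le> 1" if n: "n \<ge> K" for n
      proof (rule modular_le_one_limit[OF e])
        show "(\<lambda>j. (p n - p j) m) \<longlonglongrightarrow> (p n - q) m" for m
          using q[of m] by (auto intro!: tendsto_intros)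
        show "eventually (\<lambda>j. modular (p n - p j) e \<le> 1) sequentially"
          unfolding eventually_sequentially
        proof (intro exI allI impI)
          fix j assume "K \<le> j"
          then have "N (p n - p j) \<le> e" using K n by (simp add: less_imp_le)
          then show "modular (p n - p j) e \<le> 1" using N_le_iff[OF diff e] by blast
        qed
      qed
      then show ?thesis by blast
    qed
    \<comment> \<open>Write \<open>q = (q - p n) + p n\<close> and give each summand radius
      \<open>r / 2\<close>; the index \<open>n\<close> may depend on \<open>r\<close>.\<close>
    have "q \<in> s" unfolding mem_s_iff
    proof (intro allI impI)
      fix r :: real assume r: "0 < r"
      then obtain n where n: "modular (p n - q) (r / 2) \<le> 1" using lim[of "r / 2"] by auto
      have "modular (q - p n) (r / 2) = modular (p n - q) (r / 2)"
        unfolding modular_def by (simp add: norm_minus_commute)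
      then have n': "modular (q - p n) (r / 2) \<le> ennreal 1" using n by simp
      obtain C where C: "0 \<le> C" "modular (p n) (r / 2) \<le> ennreal C"
        using ps[of n] r modular_finiteE[of "p n" "r / 2"] by (auto simp: mem_s_iff)
      from modular_add[OF _ _ _ C(1) n' C(2)] r
      show "modular q r < \<infinity>" by (intro modular_finiteI[of _ _ "(r / 2 + r * C / 2) / r"]) simp
    qed
    moreover have "\<exists>K. \<forall>n\<ge>K. p n \<in> s \<and> norm_dist N (p n) q < e" if e: "0 < e" for e
    proof -
      \<comment> \<open>Radius \<open>e / 2\<close> turns the non-strict bound of
        \<open>N_le\<close> into the strict one needed for convergence.\<close>
      obtain K where "\<forall>n\<ge>K. modular (p n - q) (e / 2) \<le> 1" using lim[of "e / 2"] e by auto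
      then have "\<forall>n\<ge>K. N (p n - q) \<le> e / 2" using N_le[of "e / 2"] e by auto
      then show ?thesis using ps e unfolding norm_dist_def by force
    qed
    ultimately show "\<exists>q. limitin mtopology p q sequentially"
      unfolding limitin_metric eventually_sequentially by blast
  qed
qed

section \<open>Maximality in the Orlicz class\<close>

lemma s_subset_class: "s \<subseteq> orlicz_class k \<Phi> w"
proof
  fix p assume "p \<in> s"
  then have "modular p 1 < \<infinity>" by (simp add: mem_s_iff)
  then show "p \<in> orlicz_class k \<Phi> w" by (simp add: modular_def orlicz_class_def)
qed

text \<open>A subspace contains \<open>p / r\<close> along with \<open>p\<close>, and membership of
  \<open>p / r\<close> in the class is finiteness of the modular of \<open>p\<close> at radius
  \<open>r\<close>.\<close>

lemma subspace_class_subset_s: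
  assumes S: "cseq.subspace S" "S \<subseteq> orlicz_class k \<Phi> w"
  shows "S \<subseteq> s"
proof
  fix p assume p: "p \<in> S"
  show "p \<in> s" unfolding mem_s_iff
  proof (intro allI impI)
    fix r :: real assume r: "0 < r"
    have "seq_scale (of_real (1 / r)) p \<in> orlicz_class k \<Phi> w"
      using S p cseq.subspace_scale by blast
    then show "modular p r < \<infinity>"
      using r unfolding orlicz_class_def modular_def seq_scale_def
      by (simp add: norm_divide norm_mult)
  qed
qed

section \<open>Separability\<close>

text \<open>Choose \<open>F\<close> whose sum is within \<open>e\<close> of the supremum of all
  finite sums; a disjoint \<open>G\<close> with sum above \<open>e\<close> would make the union
  exceed that supremum.\<close>

lemma modular_tail:
  assumes r: "0 < r" and fin: "modular p r < \<infinity>" and e: "0 < e"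
  obtains F where "finite F"
    "\<And>G. finite G \<Longrightarrow> G \<inter> F = {} \<Longrightarrow> (\<Sum>m\<in>G. v m * \<Phi> (cmod (p m) / r)) \<le> e"
proof -
  let ?h = "\<lambda>F. \<Sum>m\<in>F. v m * \<Phi> (cmod (p m) / r)"
  obtain C where C: "0 \<le> C" "modular p r \<le> ennreal C" using modular_finiteE[OF fin] .
  then have bdd: "bdd_above (?h ` Collect finite)"
    using modular_le_iff[OF r C(1)] by (auto intro: bdd_aboveI2)
  have "\<exists>y\<in>?h ` Collect finite. Sup (?h ` Collect finite) - e < y"
    using e finite.emptyI by (intro less_cSupD) auto
  then obtain F where F: "finite F" "Sup (?h ` Collect finite) - e < ?h F"
    by blast
  have "?h G \<le> e" if G: "finite G" "G \<inter> F = {}" for G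
  proof -
    have "?h G + ?h F = ?h (G \<union> F)" using G F by (simp add: sum.union_disjoint)
    also have "\<dots> \<le> Sup (?h ` Collect finite)" using G F bdd by (intro cSup_upper) auto
    finally show ?thesis using F by linarith
  qed
  then show ?thesis using that F by blast
qed

text \<open>Values are constrained to \<open>D\<close> only on \<open>F\<close>, so vanishing
  elsewhere is allowed whether or not \<open>D\<close> contains 0.\<close>

definition finsupp_on :: "complex set \<Rightarrow> (int \<Rightarrow> complex) set" where
  "finsupp_on D = {q. \<exists>F. finite F \<and> q ` F \<subseteq> D \<and> (\<forall>m. m \<notin> F \<longrightarrow> q m = 0)}"

text \<open>Each such sequence is the lookup function, with default 0, of a finite association list
  over a countable set.\<close>

lemma countable_finsupp_on:
  assumes "countable D"
  shows "countable (finsupp_on D)"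
proof -
  let ?g = "\<lambda>xs (m::int). case map_of xs m of None \<Rightarrow> 0 | Some z \<Rightarrow> z"
  have "finsupp_on D \<subseteq> ?g ` lists (UNIV \<times> D)"
  proof
    fix q assume "q \<in> finsupp_on D"
    then obtain F where F: "finite F" "q ` F \<subseteq> D" "\<And>m. m \<notin> F \<Longrightarrow> q m = 0"
      unfolding finsupp_on_def by blast
    obtain ms where ms: "set ms = F" using finite_list[OF F(1)] by blast
    let ?xs = "map (\<lambda>m. (m, q m)) ms"
    have "?xs \<in> lists (UNIV \<times> D)" using F(2) ms by (auto simp: image_subset_iff)
    moreover have "q = ?g ?xs"
      using F(3) ms by (auto simp: fun_eq_iff map_of_map_restrict restrict_map_def)
    ultimately show "q \<in> ?g ` lists (UNIV \<times> D)" by blast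
  qed
  moreover have "countable (?g ` lists (UNIV \<times> D))"
    using assms by (intro countable_image countable_lists countable_SIGMA countableI_type)
  ultimately show ?thesis by (rule countable_subset)
qed

lemma finsupp_on_subset_s: "finsupp_on D \<subseteq> s"
proof
  fix q assume "q \<in> finsupp_on D"
  then obtain F where F: "finite F" "\<And>m. m \<notin> F \<Longrightarrow> q m = 0"
    unfolding finsupp_on_def by blast
  show "q \<in> s" unfolding mem_s_iff
  proof (intro allI impI)
    fix r :: real assume r: "0 < r"
    let ?h = "\<lambda>m. v m * \<Phi> (cmod (q m) / r)"
    have nn: "0 \<le> ?h m" for m using v_pos[of m] Phi_nonneg[of "cmod (q m) / r"] r by simp
    have "sum ?h G \<le> sum ?h F" if "finite G" for G
    proof -
      have "sum ?h G = sum ?h (G \<inter> F)" using that F by (intro sum.mono_neutral_right) auto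
      also have "\<dots> \<le> sum ?h F" using F nn by (intro sum_mono2) auto
      finally show ?thesis .
    qed
    then have "modular q r \<le> ennreal (sum ?h F)"
      using modular_le_iff[OF r, of "sum ?h F" q] nn by (auto simp: sum_nonneg)
    then show "modular q r < \<infinity>" by (rule modular_finiteI)
  qed
qed

lemma finsupp_on_dense:
  assumes D: "\<And>U :: complex set. open U \<Longrightarrow> U \<noteq> {} \<Longrightarrow> \<exists>z\<in>D. z \<in> U"
    and p: "p \<in> s" and e: "0 < e"
  shows "\<exists>q\<in>finsupp_on D. N (p - q) \<le> e"
proof -
  have "modular p e < \<infinity>" using p e by (simp add: mem_s_iff)
  then obtain F where F: "finite F"
    and tail: "\<And>G. finite G \<Longrightarrow> G \<inter> F = {} \<Longrightarrow> (\<Sum>m\<in>G. v m * \<Phi> (cmod (p m) / e)) \<le> 1 / 2"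
    using modular_tail[OF e, of p "1 / 2"] by auto
  \<comment> \<open>As \<open>d\<close> decreases to 0 this finite sum tends to 0, which yields one
    accuracy \<open>d\<close> that serves all coordinates in \<open>F\<close>.\<close>
  have "((\<lambda>d. \<Sum>m\<in>F. v m * \<Phi> (d / e)) \<longlongrightarrow> (\<Sum>m\<in>F. v m * \<Phi> (0 / e))) (at_right 0)"
  proof (intro tendsto_sum tendsto_mult tendsto_const Phi_tendsto)
    show "eventually (\<lambda>d. 0 \<le> d / e) (at_right 0)"
      using eventually_at_right_less[of 0] by eventually_elim (use e in auto)
  qed (use e in \<open>auto intro!: tendsto_eq_intros\<close>)
  then have "eventually (\<lambda>d. (\<Sum>m\<in>F. v m * \<Phi> (d / e)) < 1 / 2) (at_right 0)"
    by (rule order_tendstoD) simp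
  then have "eventually (\<lambda>d. 0 < d \<and> (\<Sum>m\<in>F. v m * \<Phi> (d / e)) < 1 / 2) (at_right 0)"
    by (intro eventually_conj eventually_at_right_less)
  then obtain d where d: "0 < d" "(\<Sum>m\<in>F. v m * \<Phi> (d / e)) < 1 / 2"
    using eventually_happens'[OF trivial_limit_at_right_real] by blast
  have "\<exists>z\<in>D. z \<in> ball (p m) d" for m using d by (intro D) auto
  then obtain z where z: "\<And>m. z m \<in> D" "\<And>m. z m \<in> ball (p m) d" by metis
  define q where "q = (\<lambda>m. if m \<in> F then z m else 0)"
  have "q \<in> finsupp_on D" unfolding finsupp_on_def q_def using F z by (auto intro!: exI[of _ F])
  moreover have "N (p - q) \<le> e"
  proof (rule N_le[OF e], subst modular_le_one_iff[OF e], intro allI impI)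
    fix G :: "int set" assume G: "finite G"
    let ?h = "\<lambda>m. v m * \<Phi> (cmod ((p - q) m) / e)"
    have "sum ?h (G \<inter> F) \<le> (\<Sum>m\<in>G \<inter> F. v m * \<Phi> (d / e))"
    proof (rule sum_mono)
      fix m assume "m \<in> G \<inter> F"
      then have "cmod ((p - q) m) \<le> d" using z(2)[of m] by (simp add: q_def dist_norm)
      then have "\<Phi> (cmod ((p - q) m) / e) \<le> \<Phi> (d / e)"
        using e by (intro Phi_mono divide_right_mono) auto
      then show "?h m \<le> v m * \<Phi> (d / e)" using v_pos[of m] by simp
    qed
    also have "\<dots> \<le> (\<Sum>m\<in>F. v m * \<Phi> (d / e))"
      using F d e v_pos Phi_nonneg by (intro sum_mono2) (auto intro!: mult_nonneg_nonneg intro: less_imp_le)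
    finally have 1: "sum ?h (G \<inter> F) \<le> 1 / 2" using d by linarith
    \<comment> \<open>Off \<open>F\<close> the approximant vanishes, so \<open>p - q\<close> agrees
      with \<open>p\<close> and the tail bound applies.\<close>
    have "sum ?h (G - F) = (\<Sum>m\<in>G - F. v m * \<Phi> (cmod (p m) / e))"
      by (rule sum.cong) (auto simp: q_def)
    also have "\<dots> \<le> 1 / 2" using G by (intro tail) auto
    finally have 2: "sum ?h (G - F) \<le> 1 / 2" .
    have "sum ?h G = sum ?h (G \<inter> F) + sum ?h (G - F)" by (rule sum.Int_Diff[OF G])
    then show "sum ?h G \<le> 1" using 1 2 by linarith
  qed
  ultimately show ?thesis by blast
qed

lemma separable_on_s: "separable_on s N"
proof -
  interpret Metric_space s "norm_dist N" by (rule Metric_space_s)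
  obtain D :: "complex set" where D: "countable D"
    "\<And>U. open U \<Longrightarrow> U \<noteq> {} \<Longrightarrow> \<exists>z\<in>D. z \<in> U"
    using countable_dense_setE by blast
  \<comment> \<open>The closure is described by closed balls, matching the non-strict bound of
    \<open>finsupp_on_dense\<close>.\<close>
  have "mtopology closure_of finsupp_on D = s"
    unfolding metric_closure_of_alt norm_dist_def mcball_def
    using finsupp_on_dense[OF D(2)] finsupp_on_subset_s[of D] by fastforce
  then show ?thesis unfolding separable_on_def separable_space_def
    using countable_finsupp_on[OF D(1)] finsupp_on_subset_s[of D]
    by (intro exI[of _ "finsupp_on D"]) simp
qed

end

theorem theorem2:
  fixes \<Phi> :: "real \<Rightarrow> real" and w :: "int \<Rightarrow> real" and k :: real
  assumes "orlicz \<Phi>" and "\<And>m. w m > 0"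
  shows "complex_banach_on (orlicz_s k \<Phi> w) (orlicz_rnorm k \<Phi> w) \<and>
    (cseq.subspace (orlicz_s k \<Phi> w) \<and> orlicz_s k \<Phi> w \<subseteq> orlicz_class k \<Phi> w \<and>
      (\<forall>S. cseq.subspace S \<and> S \<subseteq> orlicz_class k \<Phi> w \<longrightarrow> S \<subseteq> orlicz_s k \<Phi> w)) \<and>
    separable_on (orlicz_s k \<Phi> w) (orlicz_rnorm k \<Phi> w)"
proof -
  interpret weighted_orlicz k \<Phi> w using assms by unfold_locales
  show ?thesis unfolding complex_banach_on_def
    by (intro conjI allI impI; (elim conjE)?)
      (rule complex_normed_on_s mcomplete_s subspace_s s_subset_class subspace_class_subset_s
        separable_on_s; assumption)+
qed

end
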